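(* Let $(X,p)$ be a partial metric space, let $\mathcal{I}$ be an admissible ideal of $\mathbb{N}$, and let $r>0$. Let $\{x_n\}$ be a sequence in $X$ which is $\mathcal{I}$-convergent to $x\in X$. Then $$\{y\in\overline{B^{p}_{r}}(x): p(x,x)=p(y,y)\}\subseteq \mathcal{I}\text{-}LIM^{r}x_n.$$
   Context: A partial metric on a non-empty set $X$ is a function $p: X\times X \to [0,\infty)$ such that for all $x,y,z\in X$: (p1) $0\le p(x,x)\le p(x,y)$; (p2) $x=y$ if and only if $p(x,x)=p(x,y)=p(y,y)$; (p3) $p(x,y)=p(y,x)$; (p4) $p(x,y)\le p(x,z)+p(z,y)-p(z,z)$. Then $(X,p)$ is called a partial metric space. The closed ball of radius $r>0$ and center $x\in X$ is $\overline{B^{p}_{r}}(x)=\{y\in X: p(x,y)\le p(x,x)+r\}$. An ideal of $\mathbb{N}$ is a family $\mathcal{I}\subset 2^{\mathbb{N}}$ with $\emptyset\in\mathcal{I}$, closed under finite unions and under taking subsets. It is non-trivial if $\mathbb{N}\notin\mathcal{I}$ and $\mathcal{I}\neq\{\emptyset\}$. An admissible ideal is a non-trivial ideal containing $\{n\}$ for every $n\in\mathbb{N}$. A sequence $\{x_n\}$ in $X$ is $\mathcal{I}$-convergent to $x\in X$ if for every $\varepsilon>0$ the set $\{n\in\mathbb{N}: |p(x_n,x)-p(x,x)|\ge \varepsilon\}$ belongs to $\mathcal{I}$. For $r\ge 0$, it is rough $\mathcal{I}$-convergent of roughness degree $r$ to $x\in X$ if for every $\varepsilon>0$ the set $\{n\in\mathbb{N}: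 |p(x_n,x)-p(x,x)|\ge r+\varepsilon\}$ belongs to $\mathcal{I}$. The rough $\mathcal{I}$-limit set $\mathcal{I}\text{-}LIM^{r}x_n$ is the set of all $x\in X$ to which $\{x_n\}$ is rough $\mathcal{I}$-convergent of roughness degree $r$. *)

theory Defs
  imports Complex_Main
begin

(* The codomain [0,oo) is rendered by real: nonnegativity of p on X follows from
   self_nonneg and self_le. *)
locale partial_metric_space =
  fixes X :: "'a set" and p :: "'a \<Rightarrow> 'a \<Rightarrow> real"
  assumes nonempty: "X \<noteq> {}"
    and self_nonneg: "x \<in> X \<Longrightarrow> 0 \<le> p x x"
    and self_le: "\<lbrakk>x \<in> X; y \<in> X\<rbrakk> \<Longrightarrow> p x x \<le> p x y"
    and eq_iff: "\<lbrakk>x \<in> X; y \<in> X\<rbrakk> \<Longrightarrow> x = y \<longleftrightarrow> p x x = p x y \<and> p x y = p y y"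
    and commute: "\<lbrakk>x \<in> X; y \<in> X\<rbrakk> \<Longrightarrow> p x y = p y x"
    and triangle: "\<lbrakk>x \<in> X; y \<in> X; z \<in> X\<rbrakk> \<Longrightarrow> p x y \<le> p x z + p z y - p z z"

definition pm_cball :: "'a set \<Rightarrow> ('a \<Rightarrow> 'a \<Rightarrow> real) \<Rightarrow> 'a \<Rightarrow> real \<Rightarrow> 'a set" where
  "pm_cball X p x r = {y \<in> X. p x y \<le> p x x + r}"

definition set_ideal :: "nat set set \<Rightarrow> bool" where
  "set_ideal I \<longleftrightarrow> {} \<in> I \<and> (\<forall>A\<in>I. \<forall>B\<in>I. A \<union> B \<in> I) \<and> (\<forall>A\<in>I. \<forall>B. B \<subseteq> A \<longrightarrow> B \<in> I)"

definition nontrivial_ideal :: "nat set set \<Rightarrow> bool" where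
  "nontrivial_ideal I \<longleftrightarrow> set_ideal I \<and> UNIV \<notin> I \<and> I \<noteq> {{}}"

definition admissible_ideal :: "nat set set \<Rightarrow> bool" where
  "admissible_ideal I \<longleftrightarrow> nontrivial_ideal I \<and> (\<forall>n. {n} \<in> I)"

definition ideal_convergent ::
    "'a set \<Rightarrow> ('a \<Rightarrow> 'a \<Rightarrow> real) \<Rightarrow> nat set set \<Rightarrow> (nat \<Rightarrow> 'a) \<Rightarrow> 'a \<Rightarrow> bool" where
  "ideal_convergent X p I s x \<longleftrightarrow>
     x \<in> X \<and> (\<forall>\<epsilon>>0. {n. \<bar>p (s n) x - p x x\<bar> \<ge> \<epsilon>} \<in> I)"

definition rough_ideal_convergent ::
    "'a set \<Rightarrow> ('a \<Rightarrow> 'a \<Rightarrow> real) \<Rightarrow> nat set set \<Rightarrow> real \<Rightarrow> (nat \<Rightarrow> 'a) \<Rightarrow> 'a \<Rightarrow> bool" where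
  "rough_ideal_convergent X p I r s x \<longleftrightarrow>
     x \<in> X \<and> (\<forall>\<epsilon>>0. {n. \<bar>p (s n) x - p x x\<bar> \<ge> r + \<epsilon>} \<in> I)"

definition rough_ideal_LIM ::
    "'a set \<Rightarrow> ('a \<Rightarrow> 'a \<Rightarrow> real) \<Rightarrow> nat set set \<Rightarrow> real \<Rightarrow> (nat \<Rightarrow> 'a) \<Rightarrow> 'a set" where
  "rough_ideal_LIM X p I r s = {x \<in> X. rough_ideal_convergent X p I r s x}"

end

theory Submission
  imports Defs
begin

text \<open>Write \<open>d(u,y) = p(u,y) - p(y,y)\<close>, which is never negative. The triangle inequality of
  a partial metric says that \<open>d(u,y) \<le> d(u,x) + d(x,y)\<close>. If \<open>y\<close> lies in the closed ball of
  radius \<open>r\<close> about \<open>x\<close> and \<open>p(x,x) = p(y,y)\<close>, then \<open>d(x,y) \<le> r\<close>. Passing from \<open>x\<close> to \<open>y\<close>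
  therefore costs at most \<open>r\<close> for every term of the sequence: an index at which the deviation
  from \<open>y\<close> is at least \<open>r + \<epsilon>\<close> is one at which the deviation from \<open>x\<close> is at least \<open>\<epsilon>\<close>. The
  indices of the second kind form a member of the ideal, and ideals are closed under subsets.\<close>

text \<open>Membership in the ball bounds \<open>p x y - p x x\<close>, whereas the triangle inequality produces
  \<open>p x y - p y y\<close>; the equality of the self-distances identifies the two. The absolute values
  cause no loss, because no distance from a point is smaller than its self-distance.\<close>

lemma (in partial_metric_space) deviation_le_deviation_center_plus_radius:
  assumes "u \<in> X" "x \<in> X" "y \<in> pm_cball X p x r" "p x x = p y y"
  shows "\<bar>p u y - p y y\<bar> \<le> \<bar>p u x - p x x\<bar> + r"
proof -
  have y: "y \<in> X" "p x y \<le> p x x + r"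
    using assms(3) by (auto simp: pm_cball_def)
  have "p y y \<le> p u y"
    using self_le[of y u] commute[of u y] assms(1) y(1) by simp
  moreover have "p u y \<le> p u x + p x y - p x x"
    using triangle assms(1,2) y(1) by blast
  ultimately show ?thesis
    using y(2) assms(4) by linarith
qed

theorem theorem3p3:
  fixes X :: "'a set" and p :: "'a \<Rightarrow> 'a \<Rightarrow> real" and I :: "nat set set"
    and r :: real and s :: "nat \<Rightarrow> 'a" and x :: 'a
  assumes "partial_metric_space X p"
    and "admissible_ideal I"
    and "r > 0"
    and "\<And>n. s n \<in> X"
    and "x \<in> X"
    and "ideal_convergent X p I s x"
  shows "{y \<in> pm_cball X p x r. p x x = p y y} \<subseteq> rough_ideal_LIM X p I r s"
proof
  fix y
  assume "y \<in> {y \<in> pm_cball X p x r. p x x = p y y}"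
  then have y: "y \<in> pm_cball X p x r" "p x x = p y y"
    by auto
  then have "y \<in> X"
    by (simp add: pm_cball_def)
  have down_closed: "B \<in> I" if "A \<in> I" "B \<subseteq> A" for A B
    using assms(2) that by (auto simp: admissible_ideal_def nontrivial_ideal_def set_ideal_def)
  have "{n. \<bar>p (s n) y - p y y\<bar> \<ge> r + \<epsilon>} \<in> I" if "\<epsilon> > 0" for \<epsilon>
  proof (rule down_closed)
    show "{n. \<bar>p (s n) x - p x x\<bar> \<ge> \<epsilon>} \<in> I"
      using assms(6) that by (simp add: ideal_convergent_def)
    have "\<bar>p (s n) y - p y y\<bar> \<le> \<bar>p (s n) x - p x x\<bar> + r" for n
      using partial_metric_space.deviation_le_deviation_center_plus_radius
        [OF assms(1) assms(4) assms(5) y] .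
    then show "{n. \<bar>p (s n) y - p y y\<bar> \<ge> r + \<epsilon>} \<subseteq> {n. \<bar>p (s n) x - p x x\<bar> \<ge> \<epsilon>}"
      by (smt (verit) Collect_mono)
  qed
  with \<open>y \<in> X\<close> show "y \<in> rough_ideal_LIM X p I r s"
    by (simp add: rough_ideal_LIM_def rough_ideal_convergent_def)
qed

end
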